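(* Let $S$ be a nonempty finite multiset of positive integers, let $n=|S|$ (counting multiplicities), and let $m=\max(S)$. Suppose that no element of $S$ has multiplicity greater than one, and that for all $a,b,c\in S$ with $a<b<c$ we have $(m-a)\geq (m-b)+(m-c)+n-3$. Then for every finite poset $(P,\leq)$ whose multiset of cardinalities of maximal chains equals $S$, we have $|P|\geq m+n-1$.
   Context: A chain in a poset is a subset any two elements of which are comparable; a chain is maximal if it is not properly contained in any other chain. The multiset of cardinalities of maximal chains of $P$ contains one entry $|C|$ for each maximal chain $C$ of $P$. *)

theory Defs
  imports Main "HOL-Library.Multiset"
begin

text \<open>
  A poset is a carrier set \<open>P\<close> with a relation \<open>r\<close> such that
  \<^term>\<open>partial_order_on P r\<close>. The multiset below is only meaningful if there are finitely
  many maximal chains, e.g. for finite \<open>P\<close>, since \<^const>\<open>mset_set\<close> is empty on infinite sets.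
\<close>

definition maxchain_cards :: "'a set \<Rightarrow> 'a rel \<Rightarrow> nat multiset" where
  "maxchain_cards P r =
     image_mset card (mset_set {C. pred_on.maxchain P (\<lambda>x y. (x, y) \<in> r) C})"

end

theory Submission
  imports Defs
begin

text \<open>
  Call a maximal chain \<open>C\<close> \<^emph>\<open>locally longest at\<close> \<open>q \<in> C\<close> if no maximal chain through \<open>q\<close> is longer.
  Fix a longest maximal chain \<open>C\<^sub>0\<close>. If every other maximal chain is locally longest at some
  element, that element lies outside \<open>C\<^sub>0\<close> and determines the chain, because the cardinalities
  are distinct; hence \<open>P - C\<^sub>0\<close> has at least \<open>n - 1\<close> elements.

  Otherwise some \<open>C\<close> can be lengthened at each of its elements, by exchanging the part above or
  the part below for that of another chain. If both are possible at the same element, the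
  exchanges give maximal chains with \<open>|D\<^sub>1| + |D\<^sub>2| = |C| + |D\<^sub>3|\<close>, which the hypothesis
  excludes. So there are consecutive elements \<open>a\<close>, \<open>b\<close> of \<open>C\<close> such that the part of \<open>C\<close> above \<open>a\<close>
  can be exchanged for a longer one and so can the part below \<open>b\<close>. The two new parts are disjoint,
  and the hypothesis forces their total size to be at least \<open>m + n - 1\<close>.
\<close>

section \<open>Maximal chains of a finite poset\<close>

locale finite_poset =
  fixes P :: "'a set" and r :: "'a rel"
  assumes finite_carrier: "finite P" and partial_order: "partial_order_on P r"
begin

abbreviation le :: "'a \<Rightarrow> 'a \<Rightarrow> bool" (infix \<open>\<sqsubseteq>\<close> 50) where
  "x \<sqsubseteq> y \<equiv> (x, y) \<in> r"

definition maxchains :: "'a set set" where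
  "maxchains = {C. pred_on.maxchain P (\<sqsubseteq>) C}"

definition lower :: "'a set \<Rightarrow> 'a \<Rightarrow> 'a set" where
  "lower C q = {x \<in> C. x \<sqsubseteq> q}"

definition upper :: "'a set \<Rightarrow> 'a \<Rightarrow> 'a set" where
  "upper C q = {x \<in> C. q \<sqsubseteq> x}"

lemma le_refl: "x \<in> P \<Longrightarrow> x \<sqsubseteq> x"
  using partial_order by (auto simp: order_on_defs refl_on_def)

lemma le_trans: "x \<sqsubseteq> y \<Longrightarrow> y \<sqsubseteq> z \<Longrightarrow> x \<sqsubseteq> z"
  using partial_order by (auto simp: order_on_defs dest: transD)

lemma le_antisym: "x \<sqsubseteq> y \<Longrightarrow> y \<sqsubseteq> x \<Longrightarrow> x = y"
  using partial_order by (auto simp: order_on_defs dest: antisymD)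

text \<open>Subsets of chains are chains, so a chain that has a proper extension already has one by
  a single element; maximality can be tested one element at a time.\<close>

lemma maxchains_iff:
  "C \<in> maxchains \<longleftrightarrow> C \<subseteq> P \<and> (\<forall>x\<in>C. \<forall>y\<in>C. x \<sqsubseteq> y \<or> y \<sqsubseteq> x) \<and>
     (\<forall>z\<in>P. (\<forall>x\<in>C. x \<sqsubseteq> z \<or> z \<sqsubseteq> x) \<longrightarrow> z \<in> C)" (is "?L \<longleftrightarrow> ?R")
proof
  assume L: ?L
  then have ch: "pred_on.chain P (\<sqsubseteq>) C" and mx: "\<And>S. pred_on.chain P (\<sqsubseteq>) S \<Longrightarrow> \<not> C \<subset> S"
    by (auto simp: maxchains_def pred_on.maxchain_def)
  have sub: "C \<subseteq> P" and tot: "\<forall>x\<in>C. \<forall>y\<in>C. x \<sqsubseteq> y \<or> y \<sqsubseteq> x"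
    using ch le_refl unfolding pred_on.chain_def by auto
  have "z \<in> C" if z: "z \<in> P" "\<forall>x\<in>C. x \<sqsubseteq> z \<or> z \<sqsubseteq> x" for z
  proof -
    have "pred_on.chain P (\<sqsubseteq>) (insert z C)"
      using sub tot z unfolding pred_on.chain_def by auto
    from mx[OF this] show ?thesis by auto
  qed
  with sub tot show ?R by blast
next
  assume R: ?R
  then have "pred_on.chain P (\<sqsubseteq>) C"
    unfolding pred_on.chain_def by auto
  moreover have False if S: "pred_on.chain P (\<sqsubseteq>) S" "C \<subset> S" for S
  proof -
    obtain z where z: "z \<in> S" "z \<notin> C" using S(2) by blast
    have zP: "z \<in> P" using z S(1) unfolding pred_on.chain_def by blast
    have "x \<sqsubseteq> z \<or> z \<sqsubseteq> x" if "x \<in> C" for x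
      using S z that le_refl[OF zP] unfolding pred_on.chain_def by (auto dest!: psubset_imp_subset)
    with R zP z(2) show False by blast
  qed
  ultimately show ?L
    unfolding maxchains_def pred_on.maxchain_def by blast
qed

lemma maxchain_subset: "C \<in> maxchains \<Longrightarrow> C \<subseteq> P"
  and maxchain_total: "C \<in> maxchains \<Longrightarrow> x \<in> C \<Longrightarrow> y \<in> C \<Longrightarrow> x \<sqsubseteq> y \<or> y \<sqsubseteq> x"
  and maxchain_maximal:
    "C \<in> maxchains \<Longrightarrow> z \<in> P \<Longrightarrow> (\<And>x. x \<in> C \<Longrightarrow> x \<sqsubseteq> z \<or> z \<sqsubseteq> x) \<Longrightarrow> z \<in> C"
  by (auto simp: maxchains_iff)

lemma finite_maxchains: "finite maxchains"
  using finite_carrier maxchain_subset by (auto intro: finite_subset[of _ "Pow P"])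

lemma finite_maxchain: "C \<in> maxchains \<Longrightarrow> finite C"
  using finite_carrier maxchain_subset finite_subset by blast

lemma ex_greatest_in_maxchain:
  assumes C: "C \<in> maxchains" and "X \<subseteq> C" "X \<noteq> {}"
  shows "\<exists>a\<in>X. \<forall>x\<in>X. x \<sqsubseteq> a"
proof -
  have "finite X" using assms finite_maxchain finite_subset by blast
  then show ?thesis using assms(3,2)
  proof (induction X rule: finite_ne_induct)
    case (singleton x)
    then show ?case using le_refl maxchain_subset[OF C] by auto
  next
    case (insert x F)
    then obtain a where a: "a \<in> F" "\<forall>y\<in>F. y \<sqsubseteq> a" by auto
    have "x \<sqsubseteq> a \<or> a \<sqsubseteq> x" "x \<sqsubseteq> x"
      using maxchain_total[OF C] insert.prems a(1) by auto
    then consider "x \<sqsubseteq> a" | "a \<sqsubseteq> x" "x \<sqsubseteq> x" by blast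
    then show ?case
    proof cases
      case 1
      with a show ?thesis by auto
    next
      case 2
      then show ?thesis using a le_trans[OF _ \<open>a \<sqsubseteq> x\<close>] by auto
    qed
  qed
qed

lemma ex_least_in_maxchain:
  assumes C: "C \<in> maxchains" and "X \<subseteq> C" "X \<noteq> {}"
  shows "\<exists>a\<in>X. \<forall>x\<in>X. a \<sqsubseteq> x"
proof -
  have "finite X" using assms finite_maxchain finite_subset by blast
  then show ?thesis using assms(3,2)
  proof (induction X rule: finite_ne_induct)
    case (singleton x)
    then show ?case using le_refl maxchain_subset[OF C] by auto
  next
    case (insert x F)
    then obtain a where a: "a \<in> F" "\<forall>y\<in>F. a \<sqsubseteq> y" by auto
    have "x \<sqsubseteq> a \<or> a \<sqsubseteq> x" "x \<sqsubseteq> x"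
      using maxchain_total[OF C] insert.prems a(1) by auto
    then consider "a \<sqsubseteq> x" | "x \<sqsubseteq> a" "x \<sqsubseteq> x" by blast
    then show ?case
    proof cases
      case 1
      with a show ?thesis by auto
    next
      case 2
      then show ?thesis using a le_trans[OF \<open>x \<sqsubseteq> a\<close>] by auto
    qed
  qed
qed

section \<open>Splicing two maximal chains at a common element\<close>

lemma splice_maxchain:
  assumes C: "C \<in> maxchains" and D: "D \<in> maxchains" and q: "q \<in> C" "q \<in> D"
  shows "lower C q \<union> upper D q \<in> maxchains"
  unfolding maxchains_iff
proof (intro conjI ballI impI)
  show "lower C q \<union> upper D q \<subseteq> P"
    using maxchain_subset[OF C] maxchain_subset[OF D] by (auto simp: lower_def upper_def)
next
  fix x y assume "x \<in> lower C q \<union> upper D q" "y \<in> lower C q \<union> upper D q"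
  then show "x \<sqsubseteq> y \<or> y \<sqsubseteq> x"
    using maxchain_total[OF C] maxchain_total[OF D] le_trans
    unfolding lower_def upper_def by blast
next
  fix z assume z: "z \<in> P" "\<forall>x\<in>lower C q \<union> upper D q. x \<sqsubseteq> z \<or> z \<sqsubseteq> x"
  have qq: "q \<sqsubseteq> q" using q C maxchain_subset le_refl by blast
  then have "q \<sqsubseteq> z \<or> z \<sqsubseteq> q" using z q by (auto simp: lower_def)
  then show "z \<in> lower C q \<union> upper D q"
  proof
    \<comment> \<open>Elements of \<open>D\<close> above \<open>q\<close> are comparable to
      \<open>z\<close> by assumption on \<open>z\<close>, those below \<open>q\<close> by
      transitivity through \<open>q\<close>; so maximality of \<open>D\<close> applies. The other
      case is dual.\<close>
    assume h: "q \<sqsubseteq> z"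
    have "z \<in> D"
    proof (rule maxchain_maximal[OF D z(1)])
      fix x assume "x \<in> D"
      then show "x \<sqsubseteq> z \<or> z \<sqsubseteq> x"
        using maxchain_total[OF D \<open>x \<in> D\<close> q(2)] h z(2) le_trans unfolding upper_def by blast
    qed
    then show ?thesis using h by (auto simp: upper_def)
  next
    assume h: "z \<sqsubseteq> q"
    have "z \<in> C"
    proof (rule maxchain_maximal[OF C z(1)])
      fix x assume "x \<in> C"
      then show "x \<sqsubseteq> z \<or> z \<sqsubseteq> x"
        using maxchain_total[OF C \<open>x \<in> C\<close> q(1)] h z(2) le_trans unfolding lower_def by blast
    qed
    then show ?thesis using h by (auto simp: lower_def)
  qed
qed

text \<open>The two pieces meet exactly in \<open>q\<close>, which is counted twice; hence the
  \<open>+ 1\<close>.\<close>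

lemma card_splice:
  assumes C: "C \<in> maxchains" and D: "D \<in> maxchains" and q: "q \<in> C" "q \<in> D"
  shows "card (lower C q \<union> upper D q) + 1 = card (lower C q) + card (upper D q)"
proof -
  have "q \<sqsubseteq> q" using q C maxchain_subset le_refl by blast
  then have "lower C q \<inter> upper D q = {q}"
    using q le_antisym by (auto simp: lower_def upper_def)
  moreover have "finite (lower C q)" "finite (upper D q)"
    using finite_maxchain[OF C] finite_maxchain[OF D] by (auto simp: lower_def upper_def)
  ultimately show ?thesis using card_Un_Int by fastforce
qed

lemma splice_self: "C \<in> maxchains \<Longrightarrow> q \<in> C \<Longrightarrow> lower C q \<union> upper C q = C"
  using maxchain_total by (fastforce simp: lower_def upper_def)

text \<open>For a maximal chain \<open>C\<close> through \<open>q\<close>, splicing with the witness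
  \<open>D\<close> at \<open>q\<close> gives a strictly longer maximal chain with the same part
  below \<open>q\<close>.\<close>

definition up_improvable :: "'a set \<Rightarrow> 'a \<Rightarrow> bool" where
  "up_improvable C q \<longleftrightarrow> (\<exists>D\<in>maxchains. q \<in> D \<and> card (upper C q) < card (upper D q))"

definition low_improvable :: "'a set \<Rightarrow> 'a \<Rightarrow> bool" where
  "low_improvable C q \<longleftrightarrow> (\<exists>D\<in>maxchains. q \<in> D \<and> card (lower C q) < card (lower D q))"

lemma improvable_if_longer:
  assumes "C \<in> maxchains" "D \<in> maxchains" "q \<in> C" "q \<in> D" "card C < card D"
  shows "up_improvable C q \<or> low_improvable C q"
proof -
  have "card C + 1 = card (lower C q) + card (upper C q)"
    "card D + 1 = card (lower D q) + card (upper D q)"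
    using card_splice[of C C q] card_splice[of D D q] assms by (simp_all add: splice_self)
  then have "card (upper C q) < card (upper D q) \<or> card (lower C q) < card (lower D q)"
    using assms(5) by linarith
  then show ?thesis using assms unfolding up_improvable_def low_improvable_def by blast
qed

text \<open>The least element of a maximal chain is minimal in \<open>P\<close>, since anything
  below it is comparable to the whole chain. So every chain through it has the trivial lower
  part.\<close>

lemma least_not_low_improvable:
  assumes C: "C \<in> maxchains" and q: "q \<in> C" "\<forall>x\<in>C. q \<sqsubseteq> x"
  shows "\<not> low_improvable C q"
proof -
  have "lower D q = {q}" if D: "D \<in> maxchains" "q \<in> D" for D
  proof -
    have "x = q" if x: "x \<in> D" "x \<sqsubseteq> q" for x
    proof -
      have "x \<in> C"
        by (rule maxchain_maximal[OF C]) (use x q D maxchain_subset le_trans in blast)+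
      with q x show ?thesis using le_antisym by blast
    qed
    moreover have "q \<sqsubseteq> q" using q by blast
    ultimately show ?thesis using D by (auto simp: lower_def)
  qed
  then show ?thesis using C q by (auto simp: low_improvable_def)
qed

lemma greatest_not_up_improvable:
  assumes C: "C \<in> maxchains" and q: "q \<in> C" "\<forall>x\<in>C. x \<sqsubseteq> q"
  shows "\<not> up_improvable C q"
proof -
  have "upper D q = {q}" if D: "D \<in> maxchains" "q \<in> D" for D
  proof -
    have "x = q" if x: "x \<in> D" "q \<sqsubseteq> x" for x
    proof -
      have "x \<in> C"
        by (rule maxchain_maximal[OF C]) (use x q D maxchain_subset le_trans in blast)+
      with q x show ?thesis using le_antisym by blast
    qed
    moreover have "q \<sqsubseteq> q" using q by blast
    ultimately show ?thesis using D by (auto simp: upper_def)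
  qed
  then show ?thesis using C q by (auto simp: up_improvable_def)
qed

text \<open>By \<open>cons\<close>, such a \<open>z\<close> is comparable to all of
  \<open>C\<close>, so maximality puts it into \<open>C\<close>.\<close>

lemma between_consecutive:
  assumes C: "C \<in> maxchains" and ab: "a \<in> C" "b \<in> C"
    and cons: "\<forall>x\<in>C. x \<sqsubseteq> a \<or> b \<sqsubseteq> x"
    and z: "z \<in> P" "a \<sqsubseteq> z" "z \<sqsubseteq> b"
  shows "z = a \<or> z = b"
proof -
  have "z \<in> C"
    by (rule maxchain_maximal[OF C z(1)]) (use cons z le_trans in blast)
  then show ?thesis using cons z le_antisym by blast
qed

end

section \<open>Consequences of distinct cardinalities and the gap condition\<close>

locale sparse_poset = finite_poset +
  fixes m :: nat
  assumes inj_card: "inj_on card maxchains"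
    and card_le_m: "C \<in> maxchains \<Longrightarrow> card C \<le> m"
    and gap: "C \<in> maxchains \<Longrightarrow> D \<in> maxchains \<Longrightarrow> E \<in> maxchains \<Longrightarrow>
      card C < card D \<Longrightarrow> card D < card E \<Longrightarrow>
      card C + m + card maxchains \<le> card D + card E + 3"
begin

text \<open>Distinct maximal chains differ in cardinality, so \<open>gap\<close> applies in one of
  the two orders, and its bound is symmetric in \<open>D\<close> and \<open>E\<close>.\<close>

lemma gap_unordered:
  assumes "C \<in> maxchains" "D \<in> maxchains" "E \<in> maxchains"
    "card C < card D" "card C < card E" "D \<noteq> E"
  shows "card C + m + card maxchains \<le> card D + card E + 3"
proof -
  have "card D \<noteq> card E" using inj_card assms by (auto dest: inj_onD)
  then show ?thesis using gap[of C D E] gap[of C E D] assms by linarith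
qed

text \<open>Substituting \<open>card D1 + card D2 = card C + card D3\<close> into the gap condition
  leaves \<open>card maxchains \<le> 3\<close>, but \<open>C\<close>, \<open>D1\<close>,
  \<open>D2\<close>, \<open>D3\<close> are four different maximal chains.\<close>

lemma not_up_and_low_improvable:
  assumes C: "C \<in> maxchains" and q: "q \<in> C"
    and up: "up_improvable C q" and low: "low_improvable C q"
  shows False
proof -
  obtain U where U: "U \<in> maxchains" "q \<in> U" "card (upper C q) < card (upper U q)"
    using up by (auto simp: up_improvable_def)
  obtain L where L: "L \<in> maxchains" "q \<in> L" "card (lower C q) < card (lower L q)"
    using low by (auto simp: low_improvable_def)
  define D1 where "D1 = lower C q \<union> upper U q"
  define D2 where "D2 = lower L q \<union> upper C q"
  define D3 where "D3 = lower L q \<union> upper U q"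
  have mem: "D1 \<in> maxchains" "D2 \<in> maxchains" "D3 \<in> maxchains"
    unfolding D1_def D2_def D3_def using splice_maxchain C q U L by auto
  have cards: "card C + 1 = card (lower C q) + card (upper C q)"
    "card D1 + 1 = card (lower C q) + card (upper U q)"
    "card D2 + 1 = card (lower L q) + card (upper C q)"
    "card D3 + 1 = card (lower L q) + card (upper U q)"
    unfolding D1_def D2_def D3_def
    using card_splice[of C C q] card_splice[of C U q] card_splice[of L C q]
      card_splice[of L U q] C q U L by (simp_all add: splice_self)
  \<comment> \<open>\<open>D1\<close> and \<open>D2\<close> are separated by their lower parts at
    \<open>q\<close>, which differ in size.\<close>
  have "lower D1 q = lower C q" "lower D2 q = lower L q"
    unfolding D1_def D2_def using q L C U le_antisym by (auto simp: lower_def upper_def)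
  then have ne: "D1 \<noteq> D2" using L by auto
  have lt: "card C < card D1" "card C < card D2" "card D1 < card D3" "card D2 < card D3"
    using cards U L by linarith+
  have "card C + m + card maxchains \<le> card D1 + card D2 + 3"
    using gap_unordered[OF C mem(1,2) lt(1,2) ne] .
  then have "m + card maxchains \<le> card D3 + 3" using cards by linarith
  then have "card maxchains \<le> 3" using card_le_m[OF mem(3)] by linarith
  moreover have "card {C, D1, D2, D3} = 4"
    using lt ne by (auto simp: card_insert_if)
  moreover have "card {C, D1, D2, D3} \<le> card maxchains"
    using C mem by (intro card_mono finite_maxchains) auto
  ultimately show False by linarith
qed

lemma large_if_improvable_everywhere:
  assumes C: "C \<in> maxchains" and ne: "C \<noteq> {}"
    and imp: "\<forall>q\<in>C. up_improvable C q \<or> low_improvable C q"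
  shows "m + card maxchains \<le> card P + 1"
proof -
  define X where "X = {q \<in> C. up_improvable C q}"
  obtain l where l: "l \<in> C" "\<forall>x\<in>C. l \<sqsubseteq> x"
    using ex_least_in_maxchain[OF C subset_refl ne] by blast
  \<comment> \<open>The least element can only be improved upwards, so \<open>X\<close> is nonempty.
    Its greatest element is \<open>a\<close>, and \<open>b\<close> will be the next element of
    \<open>C\<close>; it lies outside \<open>X\<close>, hence can be improved downwards.\<close>
  have "l \<in> X" using least_not_low_improvable[OF C l] imp l by (auto simp: X_def)
  then have "X \<noteq> {}" by blast
  then obtain a where a: "a \<in> X" "\<forall>x\<in>X. x \<sqsubseteq> a"
    using ex_greatest_in_maxchain[OF C, of X] by (auto simp: X_def)
  have aC: "a \<in> C" and aup: "up_improvable C a" using a by (auto simp: X_def)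
  define Y where "Y = {x \<in> C. \<not> x \<sqsubseteq> a}"
  have "Y \<noteq> {}" using greatest_not_up_improvable[OF C aC] aup by (auto simp: Y_def)
  then obtain b where b: "b \<in> Y" "\<forall>x\<in>Y. b \<sqsubseteq> x"
    using ex_least_in_maxchain[OF C, of Y] by (auto simp: Y_def)
  have bC: "b \<in> C" and nba: "\<not> b \<sqsubseteq> a" using b by (auto simp: Y_def)
  have ab: "a \<sqsubseteq> b" using maxchain_total[OF C aC bC] nba by blast
  have cons: "\<forall>x\<in>C. x \<sqsubseteq> a \<or> b \<sqsubseteq> x" using b by (auto simp: Y_def)
  have nbup: "\<not> up_improvable C b" using a bC nba by (auto simp: X_def)
  then have blow: "low_improvable C b" using imp bC by blast
  have nalow: "\<not> low_improvable C a" using not_up_and_low_improvable[OF C aC aup] by blast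
  have aa: "a \<sqsubseteq> a" and bb: "b \<sqsubseteq> b" using le_refl maxchain_subset[OF C] aC bC by auto
  obtain U where U: "U \<in> maxchains" "a \<in> U" "card (upper C a) < card (upper U a)"
    using aup by (auto simp: up_improvable_def)
  obtain L where L: "L \<in> maxchains" "b \<in> L" "card (lower C b) < card (lower L b)"
    using blow by (auto simp: low_improvable_def)
  have fin: "finite C" "finite U" "finite L" using finite_maxchain C U L by auto
  have between: "z = a \<or> z = b" if "z \<in> P" "a \<sqsubseteq> z" "z \<sqsubseteq> b" for z
    using between_consecutive[OF C aC bC cons that] .

  \<comment> \<open>With nothing strictly between \<open>a\<close> and \<open>b\<close>, passing
    from \<open>b\<close> to \<open>a\<close> adds only \<open>a\<close> to the upper part of any
    maximal chain through both.\<close>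
  have upper_step: "card (upper D a) = card (upper D b) + 1"
    if D: "D \<in> maxchains" "a \<in> D" "b \<in> D" for D
  proof -
    have "upper D a = insert a (upper D b)"
    proof (intro set_eqI iffI)
      fix x assume "x \<in> upper D a"
      then have x: "x \<in> D" "a \<sqsubseteq> x" by (auto simp: upper_def)
      then show "x \<in> insert a (upper D b)"
        using maxchain_total[OF D(1) x(1) D(3)] between[of x] maxchain_subset[OF D(1)] bb
        by (auto simp: upper_def)
    qed (use D aa le_trans[OF ab] in \<open>auto simp: upper_def\<close>)
    moreover have "a \<notin> upper D b" using nba by (auto simp: upper_def)
    moreover have "finite (upper D b)" using finite_maxchain[OF D(1)] by (auto simp: upper_def)
    ultimately show ?thesis by simp
  qed
  have lower_step: "card (lower D b) = card (lower D a) + 1"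
    if D: "D \<in> maxchains" "a \<in> D" "b \<in> D" for D
  proof -
    have "lower D b = insert b (lower D a)"
    proof (intro set_eqI iffI)
      fix x assume "x \<in> lower D b"
      then have x: "x \<in> D" "x \<sqsubseteq> b" by (auto simp: lower_def)
      then show "x \<in> insert b (lower D a)"
        using maxchain_total[OF D(1) x(1) D(2)] between[of x] maxchain_subset[OF D(1)] aa
        by (auto simp: lower_def)
    qed (use D bb le_trans[OF _ ab] in \<open>auto simp: lower_def\<close>)
    moreover have "b \<notin> lower D a" using nba by (auto simp: lower_def)
    moreover have "finite (lower D a)" using finite_maxchain[OF D(1)] by (auto simp: lower_def)
    ultimately show ?thesis by simp
  qed
  \<comment> \<open>If \<open>U\<close> contained \<open>b\<close>, both upper parts would shrink by
    one, and \<open>U\<close> would improve \<open>C\<close> upwards at \<open>b\<close> as well.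
    Dually, \<open>a\<close> in \<open>L\<close> would make \<open>C\<close> improvable downwards at
    \<open>a\<close>, contrary to \<open>nalow\<close>.\<close>
  have bU: "b \<notin> U"
  proof
    assume "b \<in> U"
    then have "card (upper C b) < card (upper U b)"
      using upper_step[OF C aC bC] upper_step[OF U(1,2)] U(3) by simp
    then show False using nbup U \<open>b \<in> U\<close> by (auto simp: up_improvable_def)
  qed
  have aL: "a \<notin> L"
  proof
    assume "a \<in> L"
    then have "card (lower C a) < card (lower L a)"
      using lower_step[OF C aC bC] lower_step[OF L(1) _ L(2)] L(3) by simp
    then show False using nalow L \<open>a \<in> L\<close> by (auto simp: low_improvable_def)
  qed

  define D1 where "D1 = lower C a \<union> upper U a"
  define D2 where "D2 = lower L b \<union> upper C b"
  have mem: "D1 \<in> maxchains" "D2 \<in> maxchains"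
    unfolding D1_def D2_def using splice_maxchain C aC bC U L by auto
  have cards: "card C + 1 = card (lower C a) + card (upper C a)"
    "card C + 1 = card (lower C b) + card (upper C b)"
    "card D1 + 1 = card (lower C a) + card (upper U a)"
    "card D2 + 1 = card (lower L b) + card (upper C b)"
    unfolding D1_def D2_def
    using card_splice[of C C a] card_splice[of C C b] card_splice[of C U a]
      card_splice[of L C b] C aC bC U L by (simp_all add: splice_self)
  have lt: "card C < card D1" "card C < card D2" using cards U L by linarith+
  have "a \<in> D1" "a \<notin> D2" using aC aa aL nba by (auto simp: D1_def D2_def lower_def upper_def)
  then have "D1 \<noteq> D2" by blast
  \<comment> \<open>Since \<open>card C = card (lower C a) + card (upper C b)\<close>, the parts of
    \<open>C\<close> kept in \<open>D1\<close> and \<open>D2\<close> cancel against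
    \<open>card C\<close>, leaving only the two new parts.\<close>
  from gap_unordered[OF C mem lt this]
  have "m + card maxchains \<le> card (upper U a) + card (lower L b) + 1"
    using cards upper_step[OF C aC bC] by linarith
  also have "card (upper U a) + card (lower L b) = card (upper U a \<union> lower L b)"
  proof (rule card_Un_disjoint[symmetric])
    \<comment> \<open>A common element would lie between \<open>a\<close> and \<open>b\<close>,
      hence equal one of them; but \<open>b\<close> is not in \<open>U\<close> and \<open>a\<close>
      is not in \<open>L\<close>.\<close>
    show "upper U a \<inter> lower L b = {}"
      using between maxchain_subset[OF U(1)] bU aL by (auto simp: upper_def lower_def)
  qed (use fin in \<open>auto simp: upper_def lower_def\<close>)
  also have "\<dots> \<le> card P"
    using maxchain_subset U(1) L(1)
    by (intro card_mono finite_carrier) (auto simp: upper_def lower_def)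
  finally show ?thesis by simp
qed

lemma card_carrier_ge:
  assumes C0: "C0 \<in> maxchains" "card C0 = m" and ne: "{} \<notin> maxchains"
  shows "m + card maxchains \<le> card P + 1"
proof (cases "\<exists>C\<in>maxchains. \<forall>q\<in>C. up_improvable C q \<or> low_improvable C q")
  case True
  then obtain C where C: "C \<in> maxchains" "\<forall>q\<in>C. up_improvable C q \<or> low_improvable C q"
    by blast
  \<comment> \<open>The empty chain would be improvable everywhere vacuously.\<close>
  then have "C \<noteq> {}" using ne by blast
  then show ?thesis using large_if_improvable_everywhere C by blast
next
  case False
  have "\<forall>C\<in>maxchains. \<exists>q. q \<in> C \<and> (\<forall>D\<in>maxchains. q \<in> D \<longrightarrow> card D \<le> card C)"
  proof
    fix C assume C: "C \<in> maxchains"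
    obtain q where q: "q \<in> C" "\<not> up_improvable C q" "\<not> low_improvable C q"
      using False C by auto
    have "card D \<le> card C" if "D \<in> maxchains" "q \<in> D" for D
      using improvable_if_longer[OF C that(1) q(1) that(2)] q(2,3) by linarith
    with q(1) show "\<exists>q. q \<in> C \<and> (\<forall>D\<in>maxchains. q \<in> D \<longrightarrow> card D \<le> card C)"
      by blast
  qed
  \<comment> \<open>\<open>f\<close> picks for each maximal chain an element at which it is locally
    longest.\<close>
  from bchoice[OF this] obtain f where f: "\<And>C. C \<in> maxchains \<Longrightarrow> f C \<in> C"
    "\<And>C D. C \<in> maxchains \<Longrightarrow> D \<in> maxchains \<Longrightarrow> f C \<in> D \<Longrightarrow> card D \<le> card C"
    by blast
  have card_eq: "C = D" if "C \<in> maxchains" "D \<in> maxchains" "card C = card D" for C D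
    using inj_card that by (auto dest: inj_onD)
  have "inj_on f (maxchains - {C0})"
  proof (rule inj_onI)
    fix C D assume CD: "C \<in> maxchains - {C0}" "D \<in> maxchains - {C0}" "f C = f D"
    \<comment> \<open>Both chains pass through the common value, so neither is longer than the
      other.\<close>
    then have "f C \<in> D" "f D \<in> C" using f(1)[of C] f(1)[of D] by auto
    then have "card C = card D" using f(2)[of C D] f(2)[of D C] CD by auto
    then show "C = D" using card_eq CD by blast
  qed
  moreover have "f ` (maxchains - {C0}) \<subseteq> P - C0"
  proof (rule image_subsetI)
    fix C assume C: "C \<in> maxchains - {C0}"
    have "f C \<notin> C0"
    proof
      \<comment> \<open>Then \<open>C\<close> is at least as long as \<open>C0\<close>, so it has
        the maximal cardinality \<open>m\<close> and equals \<open>C0\<close>.\<close>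
      assume "f C \<in> C0"
      then have "card C = card C0" using f(2)[of C C0] C C0 card_le_m[of C] by auto
      then show False using card_eq[of C C0] C C0 by blast
    qed
    then show "f C \<in> P - C0" using f(1)[of C] maxchain_subset[of C] C by blast
  qed
  ultimately have "card (maxchains - {C0}) \<le> card (P - C0)"
    using finite_carrier by (auto intro: card_inj_on_le)
  moreover have "card (P - C0) + m = card P"
    using C0 maxchain_subset finite_carrier finite_maxchain
    by (metis card_Diff_subset card_mono le_add_diff_inverse2)
  moreover have "card (maxchains - {C0}) + 1 = card maxchains"
    using C0 finite_maxchains by (metis Suc_eq_plus1 card_Suc_Diff1)
  ultimately show ?thesis by linarith
qed

end

section \<open>Translation of the multiset hypotheses to maximal chains\<close>

lemma inj_on_if_count_image_mset_le_1:
  assumes "finite A" and "\<forall>x \<in># image_mset f (mset_set A). count (image_mset f (mset_set A)) x \<le> 1"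
  shows "inj_on f A"
proof (rule inj_onI, rule ccontr)
  fix x y assume xy: "x \<in> A" "y \<in> A" "f x = f y" "x \<noteq> y"
  \<comment> \<open>The multiplicity of \<open>f x\<close> is the size of the fibre of
    \<open>f\<close> over it.\<close>
  have "card {x, y} \<le> card {z \<in> A. f x = f z}"
    using xy assms(1) by (intro card_mono) auto
  also have "\<dots> = count (image_mset f (mset_set A)) (f x)"
    using assms(1) by (simp add: count_image_mset')
  also have "\<dots> \<le> 1" using assms xy by simp
  finally show False using xy by simp
qed

theorem theorem3:
  fixes S :: "nat multiset" and n m :: nat and P :: "'a set" and r :: "'a rel"
  assumes "S \<noteq> {#}"
    and "\<forall>x \<in># S. x > 0"
    and "n = size S"
    and "m = Max (set_mset S)"
    and "\<forall>x \<in># S. count S x \<le> 1"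
    and "\<forall>a \<in># S. \<forall>b \<in># S. \<forall>c \<in># S. a < b \<and> b < c \<longrightarrow>
           int m - int a \<ge> (int m - int b) + (int m - int c) + int n - 3"
    and "finite P" and "partial_order_on P r"
    and "maxchain_cards P r = S"
  shows "card P \<ge> m + n - 1"
proof -
  interpret finite_poset P r using assms by unfold_locales
  have S: "S = image_mset card (mset_set maxchains)"
    using assms(9) by (simp add: maxchain_cards_def maxchains_def)
  have setS: "set_mset S = card ` maxchains" using finite_maxchains by (simp add: S)
  have n: "n = card maxchains" using assms(3) by (simp add: S)
  have "inj_on card maxchains"
    using inj_on_if_count_image_mset_le_1[OF finite_maxchains] assms(5) unfolding S by blast
  moreover have "card C \<le> m" if "C \<in> maxchains" for C
    using that finite_maxchains by (simp add: assms(4) setS)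
  moreover have "card C + m + card maxchains \<le> card D + card E + 3"
    if "C \<in> maxchains" "D \<in> maxchains" "E \<in> maxchains" "card C < card D" "card D < card E" for C D E
  proof -
    \<comment> \<open>Moving all subtracted terms across turns the integer inequality into the
      additive form over the naturals, free of truncated subtraction.\<close>
    have "int m - int (card C) \<ge>
        (int m - int (card D)) + (int m - int (card E)) + int n - 3"
      using assms(6) that unfolding setS by blast
    then show ?thesis unfolding n by linarith
  qed
  ultimately interpret sparse_poset P r m by unfold_locales
  have "m \<in> card ` maxchains"
    using Max_in[of "set_mset S"] assms(1,4) by (simp flip: setS)
  then obtain C0 where C0: "C0 \<in> maxchains" "card C0 = m" by blast
  \<comment> \<open>An empty maximal chain would put \<open>0\<close> into \<open>S\<close>, against
    positivity.\<close>
  have "{} \<notin> maxchains" using assms(2) unfolding setS by force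
  from card_carrier_ge[OF C0 this] show ?thesis by (simp add: n)
qed

end
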